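(* Let $\psi:\mathbb{R}^d\times\mathbb{R}^d\to\mathbb{R}$ be a positive, bounded, continuous function. Assume that $\alpha:[0,+\infty)\to[0,1]$ is continuous and that there exist constants $T>0$, $\bar\alpha>0$ and a sequence $\{t_n\}_{n\ge 0}$ of nonnegative numbers with $t_0=0$, $t_n\to\infty$ as $n\to\infty$, such that for all integers $n\ge 1$ $$t_n-t_{n-1}\le T\qquad\text{and}\qquad \int_{t_{n-1}}^{t_n}\alpha(t)\,dt\ge\bar\alpha .$$ Let $N\ge 2$. Then every solution $\{x_i\}_{i=1,\dots,N}$ of $$\frac{d}{dt}x_i(t)=\sum_{j=1}^N\alpha(t)a_{ij}(t)\,(x_j(t)-x_i(t)),\quad t>0,\ i=1,\dots,N,$$ with initial conditions $x_i(0)=x_i^0\in\mathbb{R}^d$, $i=1,\dots,N$, satisfies $$d(t)\le d(0)\,e^{-\gamma(t-T)}\qquad\text{for all } t\ge 0,$$ for a suitable positive constant $\gamma$ independent of $N$.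
   Context: Here $x_i(t)\in\mathbb{R}^d$ is the opinion of the $i$-th agent, and a solution is a family of functions $x_i:[0,\infty)\to\mathbb{R}^d$ continuous on $[0,\infty)$ and differentiable for $t>0$ satisfying the system. The communication rates are $a_{ij}(t)=\frac{1}{N-1}\psi(x_i(t),x_j(t))$. The diameter is $d(t):=\max_{i,j=1,\dots,N}|x_i(t)-x_j(t)|$, where $|\cdot|$ is the Euclidean norm on $\mathbb{R}^d$. *)

theory Defs
  imports "HOL-Analysis.Analysis"
begin

text \<open>
  Agents are indexed by \<open>{1..N}\<close>; a family of opinions is \<open>x :: nat \<Rightarrow> real \<Rightarrow> real ^ 'd\<close>, of which
  only the values \<open>x i t\<close> with \<open>i \<in> {1..N}\<close> and \<open>t \<ge> 0\<close> matter. The norm of \<open>real ^ 'd\<close> is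
  the Euclidean one.
\<close>

definition comm_rate ::
  "nat \<Rightarrow> ((real ^ 'd) \<times> (real ^ 'd) \<Rightarrow> real) \<Rightarrow> (nat \<Rightarrow> real \<Rightarrow> real ^ 'd) \<Rightarrow> nat \<Rightarrow> nat \<Rightarrow> real \<Rightarrow> real"
  where "comm_rate N \<psi> x i j t = 1 / (real N - 1) * \<psi> (x i t, x j t)"

definition HK_solution ::
  "nat \<Rightarrow> ((real ^ 'd) \<times> (real ^ 'd) \<Rightarrow> real) \<Rightarrow> (real \<Rightarrow> real) \<Rightarrow> (nat \<Rightarrow> real ^ 'd)
    \<Rightarrow> (nat \<Rightarrow> real \<Rightarrow> real ^ 'd) \<Rightarrow> bool"
  where "HK_solution N \<psi> \<alpha> x0 x \<longleftrightarrow>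
    (\<forall>i\<in>{1..N}.
       continuous_on {0..} (x i) \<and>
       x i 0 = x0 i \<and>
       (\<forall>t>0. (x i has_vector_derivative
          (\<Sum>j=1..N. (\<alpha> t * comm_rate N \<psi> x i j t) *\<^sub>R (x j t - x i t))) (at t)))"

definition opinion_diameter :: "nat \<Rightarrow> (nat \<Rightarrow> real \<Rightarrow> real ^ 'd) \<Rightarrow> real \<Rightarrow> real"
  where "opinion_diameter N x t = Max {norm (x i t - x j t) | i j. i \<in> {1..N} \<and> j \<in> {1..N}}"

end

theory Submission
  imports Defs
begin

text \<open>
  At a time when the pair \<open>i\<close>, \<open>j\<close> realises the diameter, put \<open>u = x\<^sub>i - x\<^sub>j\<close>. Every opinion
  \<open>x\<^sub>k\<close> satisfies \<open>u \<bullet> (x\<^sub>k - x\<^sub>i) \<le> 0 \<le> u \<bullet> (x\<^sub>k - x\<^sub>j)\<close>, so all the communication rates may be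
  replaced by a lower bound \<open>m / (N - 1)\<close>; the terms in \<open>x\<^sub>k\<close> then cancel, and the derivative of
  \<open>|u|\<^sup>2\<close> is at most \<open>-2 \<alpha> m |u|\<^sup>2\<close>. Hence \<open>d(t) \<le> d(0) exp (-m \<integral>\<alpha>)\<close>, and the integral grows at least
  by \<open>\<alpha>bar\<close> over each \<open>[\<tau>\<^sub>n, \<tau>\<^sub>n\<^sub>+\<^sub>1]\<close>, which takes at most time \<open>T\<close>. Since the largest norm of an opinion does not increase,
  \<open>m\<close> can be taken as the minimum of \<open>\<psi>\<close> over a ball that contains the initial opinions, and does not
  depend on \<open>N\<close>.
\<close>

section \<open>A maximum principle for finite families\<close>

text \<open>The pointwise maximum of the family need not be differentiable where the maximising
  member changes. So the maximum is taken over members and times in \<open>{0..t}\<close> at once;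
  after a perturbation it can only sit at time 0.\<close>

lemma finite_family_max_le_initial:
  fixes g g' :: "'k \<Rightarrow> real \<Rightarrow> real"
  assumes fin: "finite K" and j: "j \<in> K" and t: "0 \<le> t"
    and cont: "\<And>k. k \<in> K \<Longrightarrow> continuous_on {0..} (g k)"
    and der: "\<And>k s. k \<in> K \<Longrightarrow> s > 0 \<Longrightarrow> (g k has_real_derivative g' k s) (at s)"
    and max: "\<And>k s. k \<in> K \<Longrightarrow> s > 0 \<Longrightarrow> (\<And>l. l \<in> K \<Longrightarrow> g l s \<le> g k s) \<Longrightarrow> g' k s \<le> 0"
  shows "\<exists>k\<in>K. g j t \<le> g k 0"
proof -
  define M where "M = Max ((\<lambda>k. g k 0) ` K)"
  \<comment> \<open>A derivative that is merely nonpositive excludes no interior maximum; the term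
    \<open>- \<epsilon> * t\<close> makes it strictly negative.\<close>
  have perturbed: "g j t - \<epsilon> * t \<le> M" if \<epsilon>: "\<epsilon> > 0" for \<epsilon>
  proof -
    define h where "h k s = g k s - \<epsilon> * s" for k s
    have "\<exists>s\<in>{0..t}. \<forall>r\<in>{0..t}. h k r \<le> h k s" if "k \<in> K" for k
    proof (rule continuous_attains_sup)
      show "continuous_on {0..t} (h k)"
        unfolding h_def
        by (intro continuous_intros continuous_on_subset[OF cont[OF that]]) auto
    qed (use t in auto)
    then obtain s where s: "\<And>k. k \<in> K \<Longrightarrow> s k \<in> {0..t}"
        "\<And>k r. k \<in> K \<Longrightarrow> r \<in> {0..t} \<Longrightarrow> h k r \<le> h k (s k)"
      by metis
    have "Max ((\<lambda>k. h k (s k)) ` K) \<in> (\<lambda>k. h k (s k)) ` K"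
      using fin j by (intro Max_in) auto
    then obtain k where k: "k \<in> K" "Max ((\<lambda>k. h k (s k)) ` K) = h k (s k)"
      by auto
    have top: "h l r \<le> h k (s k)" if "l \<in> K" "r \<in> {0..t}" for l r
    proof -
      have "h l (s l) \<le> Max ((\<lambda>k. h k (s k)) ` K)"
        using fin that by (intro Max_ge) auto
      with s(2)[OF that] k show ?thesis by simp
    qed
    \<comment> \<open>At a positive time the negative derivative yields larger values just before.
      Looking only to the left also covers \<open>s k = t\<close>.\<close>
    have "s k = 0"
    proof (rule ccontr)
      assume "s k \<noteq> 0"
      with s(1)[OF k(1)] have sk: "s k > 0" "s k \<le> t" by auto
      have "g' k (s k) \<le> 0"
      proof (rule max[OF k(1) sk(1)])
        fix l assume "l \<in> K"
        from top[OF this, of "s k"] sk show "g l (s k) \<le> g k (s k)"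
          by (simp add: h_def)
      qed
      moreover have "(h k has_real_derivative g' k (s k) - \<epsilon>) (at (s k))"
        unfolding h_def by (auto intro!: derivative_eq_intros der[OF k(1) sk(1)])
      ultimately obtain \<delta> where \<delta>: "\<delta> > 0" "\<And>r. r > 0 \<Longrightarrow> r < \<delta> \<Longrightarrow> h k (s k) < h k (s k - r)"
        using DERIV_neg_dec_left[of "h k" "g' k (s k) - \<epsilon>" "s k"] \<epsilon> by auto
      define r where "r = min (\<delta> / 2) (s k)"
      have "h k (s k) < h k (s k - r)" "s k - r \<in> {0..t}"
        using \<delta> sk by (auto simp: r_def)
      with top[OF k(1), of "s k - r"] show False by simp
    qed
    moreover have "h k 0 \<le> M"
      unfolding M_def h_def using fin k by auto
    ultimately show ?thesis
      using top[OF j, of t] t by (simp add: h_def)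
  qed
  have "g j t \<le> M"
  proof (rule field_le_epsilon)
    fix e :: real assume "e > 0"
    \<comment> \<open>Dividing by \<open>t + 1\<close> instead of \<open>t\<close> includes the case
      \<open>t = 0\<close>.\<close>
    with perturbed[of "e / (t + 1)"] t have "g j t - e * (t / (t + 1)) \<le> M"
      by simp
    moreover have "e * (t / (t + 1)) \<le> e * 1"
      using \<open>e > 0\<close> t by (intro mult_left_mono) auto
    ultimately show "g j t \<le> M + e" by simp
  qed
  moreover have "M \<in> (\<lambda>k. g k 0) ` K"
    unfolding M_def using fin j by (intro Max_in) auto
  ultimately show ?thesis by auto
qed

section \<open>Velocities in extreme directions and boundedness of the opinions\<close>

definition HK_velocity ::
  "nat \<Rightarrow> ((real ^ 'd) \<times> (real ^ 'd) \<Rightarrow> real) \<Rightarrow> (real \<Rightarrow> real) \<Rightarrow> (nat \<Rightarrow> real \<Rightarrow> real ^ 'd)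
    \<Rightarrow> nat \<Rightarrow> real \<Rightarrow> real ^ 'd"
  where "HK_velocity N \<psi> \<alpha> x i t =
    (\<Sum>j=1..N. (\<alpha> t * comm_rate N \<psi> x i j t) *\<^sub>R (x j t - x i t))"

lemma HK_solutionD:
  assumes "HK_solution N \<psi> \<alpha> x0 x" "i \<in> {1..N}"
  shows "continuous_on {0..} (x i)" "x i 0 = x0 i"
    "t > 0 \<Longrightarrow> (x i has_vector_derivative HK_velocity N \<psi> \<alpha> x i t) (at t)"
  using assms unfolding HK_solution_def HK_velocity_def by auto

lemma has_real_derivative_norm_power2:
  assumes "(f has_vector_derivative f') (at t)"
  shows "((\<lambda>t. (norm (f t))\<^sup>2) has_real_derivative 2 * (f t \<bullet> f')) (at t)"
  using has_derivative_inner[OF assms[unfolded has_vector_derivative_def]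
      assms[unfolded has_vector_derivative_def]]
  unfolding has_field_derivative_def power2_norm_eq_inner
  by (rule has_derivative_eq_rhs) (auto simp: inner_commute algebra_simps)

text \<open>If agent \<open>i\<close> is extreme in direction \<open>u\<close>, every summand is
  nonpositive, so lowering its rate can only raise the sum. With equal rates the sum becomes linear
  in the opinions.\<close>

lemma inner_HK_velocity_le:
  assumes "N \<ge> 2" "\<alpha> t \<ge> 0" "i \<in> {1..N}"
    and lower: "\<And>j. j \<in> {1..N} \<Longrightarrow> m \<le> \<psi> (x i t, x j t)"
    and le: "\<And>j. j \<in> {1..N} \<Longrightarrow> u \<bullet> (x j t - x i t) \<le> 0"
  shows "u \<bullet> HK_velocity N \<psi> \<alpha> x i t
    \<le> \<alpha> t * (m / (real N - 1)) * (\<Sum>j=1..N. u \<bullet> (x j t - x i t))"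
proof -
  have "u \<bullet> HK_velocity N \<psi> \<alpha> x i t
      = (\<Sum>j=1..N. (\<alpha> t * comm_rate N \<psi> x i j t) * (u \<bullet> (x j t - x i t)))"
    unfolding HK_velocity_def inner_sum_right by simp
  also have "\<dots> \<le> (\<Sum>j=1..N. (\<alpha> t * (m / (real N - 1))) * (u \<bullet> (x j t - x i t)))"
  proof (rule sum_mono)
    fix j assume j: "j \<in> {1..N}"
    have "\<alpha> t * (m / (real N - 1)) \<le> \<alpha> t * comm_rate N \<psi> x i j t"
      unfolding comm_rate_def using assms(1,2) lower[OF j]
      by (intro mult_left_mono) (auto simp: divide_right_mono)
    then show "\<alpha> t * comm_rate N \<psi> x i j t * (u \<bullet> (x j t - x i t))
        \<le> \<alpha> t * (m / (real N - 1)) * (u \<bullet> (x j t - x i t))"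
      using le[OF j] by (rule mult_right_mono_neg)
  qed
  finally show ?thesis by (simp add: sum_distrib_left)
qed

text \<open>By Cauchy-Schwarz the agent of largest norm is extreme in the direction of its own
  opinion, so its squared norm has nonpositive derivative. This confines solutions to a ball
  independent of \<open>N\<close>.\<close>

lemma HK_solution_norm_le:
  assumes sol: "HK_solution N \<psi> \<alpha> x0 x" and N: "N \<ge> 2"
    and psi: "\<And>p. \<psi> p > 0" and alpha: "\<And>t. t \<ge> 0 \<Longrightarrow> \<alpha> t \<ge> 0"
    and init: "\<And>i. i \<in> {1..N} \<Longrightarrow> norm (x0 i) \<le> R"
    and "i \<in> {1..N}" "t \<ge> 0"
  shows "norm (x i t) \<le> R"
proof -
  have "\<exists>k\<in>{1..N}. (norm (x i t))\<^sup>2 \<le> (norm (x k 0))\<^sup>2"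
  proof (rule finite_family_max_le_initial[where g = "\<lambda>i t. (norm (x i t))\<^sup>2"
        and g' = "\<lambda>i t. 2 * (x i t \<bullet> HK_velocity N \<psi> \<alpha> x i t)"])
    fix k s assume k: "k \<in> {1..N}" and s: "s > (0::real)"
      and top: "\<And>l. l \<in> {1..N} \<Longrightarrow> (norm (x l s))\<^sup>2 \<le> (norm (x k s))\<^sup>2"
    have "x k s \<bullet> (x l s - x k s) \<le> 0" if "l \<in> {1..N}" for l
    proof -
      have "norm (x l s) \<le> norm (x k s)"
        using top[OF that] by (simp add: power2_le_iff_abs_le)
      then have "norm (x k s) * norm (x l s) \<le> norm (x k s) * norm (x k s)"
        by (simp add: mult_left_mono)
      with norm_cauchy_schwarz[of "x k s" "x l s"] show ?thesis
        by (simp add: inner_diff_right dot_square_norm power2_eq_square)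
    qed
    \<comment> \<open>The choice \<open>m = 0\<close> suffices here and makes the right-hand side
      vanish.\<close>
    then have "x k s \<bullet> HK_velocity N \<psi> \<alpha> x k s
        \<le> \<alpha> s * (0 / (real N - 1)) * (\<Sum>l=1..N. x k s \<bullet> (x l s - x k s))"
      using s by (intro inner_HK_velocity_le N k alpha less_imp_le[OF psi]) auto
    then show "2 * (x k s \<bullet> HK_velocity N \<psi> \<alpha> x k s) \<le> 0"
      by simp
  next
    fix k s assume "k \<in> {1..N}" "s > (0::real)"
    then show "((\<lambda>t. (norm (x k t))\<^sup>2) has_real_derivative
        2 * (x k s \<bullet> HK_velocity N \<psi> \<alpha> x k s)) (at s)"
      by (intro has_real_derivative_norm_power2 HK_solutionD(3)[OF sol])
  qed (use assms in \<open>auto intro!: continuous_intros HK_solutionD(1)[OF sol]\<close>)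
  then obtain k where "k \<in> {1..N}" "norm (x i t) \<le> norm (x k 0)"
    by (auto simp: power2_le_iff_abs_le)
  with init[of k] HK_solutionD(2)[OF sol, of k] show ?thesis by simp
qed

section \<open>Decay of the pairwise distances\<close>

text \<open>The ball around \<open>b\<close> through \<open>a\<close> lies on one side of its
  tangent hyperplane at \<open>a\<close>.\<close>

lemma inner_diff_le_if_diameter:
  fixes a b y :: "'a :: real_inner"
  assumes "norm (y - b) \<le> norm (a - b)"
  shows "(a - b) \<bullet> (y - a) \<le> 0"
proof -
  have "(a - b) \<bullet> (y - b) \<le> norm (a - b) * norm (a - b)"
    using norm_cauchy_schwarz[of "a - b" "y - b"] assms mult_left_mono[OF assms, of "norm (a - b)"]
    by simp
  moreover have "(a - b) \<bullet> (y - a) = (a - b) \<bullet> (y - b) - (a - b) \<bullet> (a - b)"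
    by (simp flip: inner_diff_right)
  ultimately show ?thesis
    by (simp add: dot_square_norm power2_eq_square)
qed

text \<open>The maximum principle is applied with pairs of agents as indices. Squared distances are
  used because they stay differentiable where two opinions coincide.\<close>

lemma HK_solution_diff_decay:
  fixes x :: "nat \<Rightarrow> real \<Rightarrow> real ^ 'd"
  assumes sol: "HK_solution N \<psi> \<alpha> x0 x" and N: "N \<ge> 2"
    and m: "m \<ge> 0"
    and lower: "\<And>i j t. i \<in> {1..N} \<Longrightarrow> j \<in> {1..N} \<Longrightarrow> t \<ge> 0 \<Longrightarrow> m \<le> \<psi> (x i t, x j t)"
    and alpha: "\<And>t. t \<ge> 0 \<Longrightarrow> \<alpha> t \<ge> 0"
    and A_cont: "continuous_on {0..} A" and A0: "A 0 = 0"
    and A: "\<And>t. t > 0 \<Longrightarrow> (A has_real_derivative \<alpha> t) (at t)"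
    and ij: "i \<in> {1..N}" "j \<in> {1..N}" and t: "t \<ge> 0"
  shows "\<exists>k\<in>{1..N}. \<exists>l\<in>{1..N}. norm (x i t - x j t) \<le> norm (x k 0 - x l 0) * exp (- m * A t)"
proof -
  define v where "v = HK_velocity N \<psi> \<alpha> x"
  define f where "f p s = (norm (x (fst p) s - x (snd p) s))\<^sup>2" for p s
  define f' where
    "f' p s = 2 * ((x (fst p) s - x (snd p) s) \<bullet> (v (fst p) s - v (snd p) s))" for p s
  have f_der: "(f p has_real_derivative f' p s) (at s)"
    if "p \<in> {1..N} \<times> {1..N}" "s > 0" for p s
    unfolding f_def f'_def v_def
    using that by (intro has_real_derivative_norm_power2 has_vector_derivative_diff
        HK_solutionD(3)[OF sol]) auto
  have f_cont: "continuous_on {0..} (f p)" if "p \<in> {1..N} \<times> {1..N}" for p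
    unfolding f_def using that by (intro continuous_intros HK_solutionD(1)[OF sol]) auto
  have decay: "f' p s \<le> - (2 * m * \<alpha> s) * f p s"
    if p: "p \<in> {1..N} \<times> {1..N}" and s: "s > 0"
      and top: "\<And>q. q \<in> {1..N} \<times> {1..N} \<Longrightarrow> f q s \<le> f p s" for p s
  proof -
    obtain k l where kl: "p = (k, l)" "k \<in> {1..N}" "l \<in> {1..N}"
      using p by auto
    define u where "u = x k s - x l s"
    have top': "norm (x a s - x b s) \<le> norm u" if "a \<in> {1..N}" "b \<in> {1..N}" for a b
      using top[of "(a, b)"] that by (simp add: f_def kl u_def power2_le_iff_abs_le)
    define c where "c = \<alpha> s * (m / (real N - 1))"
    have c: "c \<ge> 0" unfolding c_def using N m s alpha[of s] by simp
    have "u \<bullet> (x q s - x k s) \<le> 0" if "q \<in> {1..N}" for q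
      unfolding u_def by (intro inner_diff_le_if_diameter) (use top'[OF that kl(3)] u_def in simp)
    then have 1: "u \<bullet> v k s \<le> c * (\<Sum>q=1..N. u \<bullet> (x q s - x k s))"
      unfolding c_def v_def using kl s by (intro inner_HK_velocity_le N alpha lower) auto
    \<comment> \<open>The other end of the diameter is extreme in the opposite direction.\<close>
    have "(- u) \<bullet> (x q s - x l s) \<le> 0" if "q \<in> {1..N}" for q
      using inner_diff_le_if_diameter[of "x q s" "x k s" "x l s"] top'[OF that kl(2)]
      by (simp add: u_def norm_minus_commute)
    then have 2: "(- u) \<bullet> v l s \<le> c * (\<Sum>q=1..N. (- u) \<bullet> (x q s - x l s))"
      unfolding c_def v_def using kl s by (intro inner_HK_velocity_le N alpha lower) auto
    have "u \<bullet> (v k s - v l s)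
        \<le> c * ((\<Sum>q=1..N. u \<bullet> (x q s - x k s)) + (\<Sum>q=1..N. (- u) \<bullet> (x q s - x l s)))"
      using 1 2 by (simp add: inner_diff_right distrib_left)
    \<comment> \<open>In each summand \<open>x q s\<close> cancels and
      \<open>u \<bullet> (x l s - x k s)\<close> remains.\<close>
    also have "(\<Sum>q=1..N. u \<bullet> (x q s - x k s)) + (\<Sum>q=1..N. (- u) \<bullet> (x q s - x l s))
        = (\<Sum>q=1..N. - (u \<bullet> u))"
      unfolding sum.distrib[symmetric]
      by (rule sum.cong) (simp_all add: u_def inner_diff_left inner_diff_right algebra_simps)
    also have "c * \<dots> = - (c * real N) * (norm u)\<^sup>2"
      by (simp add: power2_norm_eq_inner)
    \<comment> \<open>The \<open>N\<close> equal terms outweigh the denominator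
      \<open>N - 1\<close>, so the rate loses its dependence on \<open>N\<close>.\<close>
    also have "\<dots> \<le> - (m * \<alpha> s) * (norm u)\<^sup>2"
    proof -
      have "c * (real N - 1) = m * \<alpha> s"
        using N by (simp add: c_def)
      then have "m * \<alpha> s \<le> c * real N"
        using c by (simp add: algebra_simps)
      then show ?thesis by (intro mult_right_mono) auto
    qed
    finally show ?thesis
      by (simp add: f_def f'_def kl u_def)
  qed
  \<comment> \<open>The integrating factor is positive and common to all pairs, so it does not
    change which pair is maximal.\<close>
  have "\<exists>p\<in>{1..N} \<times> {1..N}. f (i, j) t * exp (2 * m * A t) \<le> f p 0 * exp (2 * m * A 0)"
  proof (rule finite_family_max_le_initial[where g = "\<lambda>p s. f p s * exp (2 * m * A s)"
        and g' = "\<lambda>p s. (f' p s + 2 * m * \<alpha> s * f p s) * exp (2 * m * A s)"])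
    fix p s assume p: "p \<in> {1..N} \<times> {1..N}" and s: "s > (0::real)"
    show "((\<lambda>s. f p s * exp (2 * m * A s)) has_real_derivative
        (f' p s + 2 * m * \<alpha> s * f p s) * exp (2 * m * A s)) (at s)"
      by (auto intro!: derivative_eq_intros f_der[OF p s] A[OF s] simp: algebra_simps)
    assume "\<And>q. q \<in> {1..N} \<times> {1..N} \<Longrightarrow>
        f q s * exp (2 * m * A s) \<le> f p s * exp (2 * m * A s)"
    with decay[OF p s] show "(f' p s + 2 * m * \<alpha> s * f p s) * exp (2 * m * A s) \<le> 0"
      by (simp add: mult_le_0_iff)
  next
    fix p assume "p \<in> {1..N} \<times> {1..N}"
    then show "continuous_on {0..} (\<lambda>s. f p s * exp (2 * m * A s))"
      by (intro continuous_intros f_cont A_cont)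
  qed (use ij t in auto)
  then obtain k l where kl: "k \<in> {1..N}" "l \<in> {1..N}"
      and le: "f (i, j) t * exp (2 * m * A t) \<le> f (k, l) 0"
    by (auto simp: A0)
  have "(norm (x i t - x j t) * exp (m * A t))\<^sup>2 = f (i, j) t * exp (2 * m * A t)"
    by (simp add: f_def power_mult_distrib exp_double[symmetric] mult.assoc)
  also have "\<dots> \<le> (norm (x k 0 - x l 0))\<^sup>2"
    using le by (simp add: f_def)
  finally have "norm (x i t - x j t) * exp (m * A t) \<le> norm (x k 0 - x l 0)"
    by (rule power2_le_imp_le) simp
  then have "norm (x i t - x j t) \<le> norm (x k 0 - x l 0) * exp (- m * A t)"
    by (simp add: exp_minus field_simps)
  with kl show ?thesis by blast
qed

lemma finite_diameter_set: "finite {norm (x i t - x j t) | i j. i \<in> {1..N} \<and> j \<in> {1..N::nat}}"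
  by (rule finite_subset[of _ "(\<lambda>(i, j). norm (x i t - x j t)) ` ({1..N} \<times> {1..N})"]) auto

lemma norm_le_opinion_diameter:
  assumes "i \<in> {1..N}" "j \<in> {1..N}"
  shows "norm (x i t - x j t) \<le> opinion_diameter N x t"
  unfolding opinion_diameter_def using assms by (intro Max_ge finite_diameter_set) auto

lemma opinion_diameter_le:
  assumes "N \<ge> 1" "\<And>i j. i \<in> {1..N} \<Longrightarrow> j \<in> {1..N} \<Longrightarrow> norm (x i t - x j t) \<le> D"
  shows "opinion_diameter N x t \<le> D"
proof -
  have "opinion_diameter N x t \<in> {norm (x i t - x j t) | i j. i \<in> {1..N} \<and> j \<in> {1..N}}"
    unfolding opinion_diameter_def using assms(1)
    by (intro Max_in finite_diameter_set) (auto intro!: exI[of _ 1])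
  with assms(2) show ?thesis by auto
qed

section \<open>Linear growth of the integral of the weight\<close>

text \<open>The complete windows before \<open>t\<close> contribute \<open>a\<close> each and last
  at most \<open>T\<close> each; the incomplete window containing \<open>t\<close> costs the shift
  by \<open>T\<close>.\<close>

lemma integral_lower_bound_recurrent:
  fixes \<alpha> :: "real \<Rightarrow> real" and \<tau> :: "nat \<Rightarrow> real"
  assumes cont: "continuous_on {0..} \<alpha>" and nonneg: "\<And>t. t \<ge> 0 \<Longrightarrow> \<alpha> t \<ge> 0"
    and "T > 0" and a: "a > 0" and tau0: "\<tau> 0 = 0"
    and lim: "filterlim \<tau> at_top sequentially"
    and step: "\<And>n. \<tau> (Suc n) - \<tau> n \<le> T"
    and int: "\<And>n. a \<le> integral {\<tau> n..\<tau> (Suc n)} \<alpha>"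
    and t: "t \<ge> 0"
  shows "a * (t - T) / T \<le> integral {0..t} \<alpha>"
proof -
  have integrable: "\<alpha> integrable_on {r..s}" if "r \<ge> 0" for r s
    using that by (intro integrable_continuous_real continuous_on_subset[OF cont]) auto
  \<comment> \<open>The integral over an empty interval is \<open>0\<close>, so its lower bound forces \<open>\<tau>\<close> to increase.\<close>
  have inc: "\<tau> n < \<tau> (Suc n)" for n
  proof (rule ccontr)
    assume "\<not> \<tau> n < \<tau> (Suc n)"
    then have "integral {\<tau> n..\<tau> (Suc n)} \<alpha> = 0"
      by (cases "\<tau> n = \<tau> (Suc n)") auto
    with int[of n] a show False by simp
  qed
  have lower: "0 \<le> \<tau> n \<and> \<tau> n \<le> real n * T \<and> real n * a \<le> integral {0..\<tau> n} \<alpha>" for n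
  proof (induction n)
    case (Suc n)
    have "integral {0..\<tau> n} \<alpha> + integral {\<tau> n..\<tau> (Suc n)} \<alpha> = integral {0..\<tau> (Suc n)} \<alpha>"
      using Suc inc[of n] by (intro Henstock_Kurzweil_Integration.integral_combine integrable) auto
    with Suc inc[of n] step[of n] int[of n] show ?case
      by (simp add: algebra_simps)
  qed (simp add: tau0)
  obtain n0 where "t < \<tau> n0"
    using lim unfolding filterlim_at_top_dense eventually_sequentially by blast
  \<comment> \<open>Minimality puts \<open>t\<close> between \<open>\<tau> k\<close> and
    \<open>\<tau> (Suc k)\<close>; the index is not 0 because
    \<open>\<tau> 0 = 0 \<le> t\<close>.\<close>
  define n where "n = (LEAST n. t < \<tau> n)"
  have "t < \<tau> n"
    unfolding n_def using \<open>t < \<tau> n0\<close> by (rule LeastI)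
  with tau0 t obtain k where k: "n = Suc k"
    by (cases n) auto
  have tk: "\<tau> k \<le> t"
    using not_less_Least[of k "\<lambda>n. t < \<tau> n"] k by (simp add: n_def)
  have "t \<le> real (Suc k) * T"
    using \<open>t < \<tau> n\<close> lower[of n] k by simp
  then have "(t - T) / T \<le> real k"
    using \<open>T > 0\<close> by (simp add: field_simps)
  then have "a * (t - T) / T \<le> real k * a"
    using a mult_left_mono[of "(t - T) / T" "real k" a] by (simp add: mult.commute)
  also have "\<dots> \<le> integral {0..\<tau> k} \<alpha>"
    using lower[of k] by simp
  also have "\<dots> \<le> integral {0..t} \<alpha>"
    using tk nonneg by (intro integral_subset_le integrable) auto
  finally show ?thesis .
qed

section \<open>Exponential consensus\<close>

text \<open>Independence of \<open>N\<close> is expressed by choosing \<open>\<gamma>\<close> before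
  \<open>N\<close>, the initial data and the solution; the bound \<open>R\<close> is the only
  information on the initial data that enters it.\<close>

theorem theorem2p1:
  fixes \<psi> :: "(real ^ 'd) \<times> (real ^ 'd) \<Rightarrow> real"
    and \<alpha> :: "real \<Rightarrow> real"
    and T \<alpha>bar R :: real
    and \<tau> :: "nat \<Rightarrow> real"
  assumes "\<forall>p. \<psi> p > 0"
    and "bounded (range \<psi>)"
    and "continuous_on UNIV \<psi>"
    and "continuous_on {0..} \<alpha>"
    and "\<forall>t\<ge>0. \<alpha> t \<in> {0..1}"
    and "T > 0"
    and "\<alpha>bar > 0"
    and "\<forall>n. \<tau> n \<ge> 0"
    and "\<tau> 0 = 0"
    and "filterlim \<tau> at_top sequentially"
    and "\<forall>n\<ge>1. \<tau> n - \<tau> (n - 1) \<le> T \<and> integral {\<tau> (n - 1)..\<tau> n} \<alpha> \<ge> \<alpha>bar"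
  shows "\<exists>\<gamma>>0. \<forall>N\<ge>2. \<forall>x0 x.
           (\<forall>i\<in>{1..N}. norm (x0 i) \<le> R) \<longrightarrow>
           HK_solution N \<psi> \<alpha> x0 x \<longrightarrow>
           (\<forall>t\<ge>0. opinion_diameter N x t \<le> opinion_diameter N x 0 * exp (- \<gamma> * (t - T)))"
proof -
  have psi: "\<psi> p > 0" for p
    using assms(1) by blast
  have alpha: "\<alpha> t \<ge> 0" if "t \<ge> 0" for t
    using assms(5) that by auto
  \<comment> \<open>The absolute value keeps the balls nonempty for negative \<open>R\<close>, so
    that a minimiser of \<open>\<psi>\<close> exists.\<close>
  define B :: "((real ^ 'd) \<times> (real ^ 'd)) set" where "B = cball 0 \<bar>R\<bar> \<times> cball 0 \<bar>R\<bar>"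
  have "\<exists>p\<in>B. \<forall>q\<in>B. \<psi> p \<le> \<psi> q"
    unfolding B_def using assms(3)
    by (intro continuous_attains_inf compact_Times compact_cball)
      (auto intro: continuous_on_subset)
  then obtain p where p: "\<And>q. q \<in> B \<Longrightarrow> \<psi> p \<le> \<psi> q" by blast
  define A where "A t = integral {0..t} \<alpha>" for t
  have alpha_cont: "continuous_on {0..b} \<alpha>" for b
    using assms(4) by (rule continuous_on_subset) auto
  have A_der: "(A has_real_derivative \<alpha> t) (at t)" if "t > 0" for t
  proof -
    have "(A has_real_derivative \<alpha> t) (at t within {0..t + 1})"
      unfolding A_def using that by (intro integral_has_real_derivative alpha_cont) auto
    moreover have "at t within {0..t + 1} = at t"
      using that by (intro at_within_interior) auto
    ultimately show ?thesis by simp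
  qed
  have A_cont: "continuous_on {0..} A"
    unfolding continuous_on_eq_continuous_within
  proof
    fix t :: real assume t: "t \<in> {0..}"
    \<comment> \<open>Continuity is local, so a compact interval reaching beyond \<open>t\<close>
      suffices.\<close>
    have "continuous_on {0..t + 1} A"
      unfolding A_def by (intro indefinite_integral_continuous_1 integrable_continuous_real alpha_cont)
    then have "continuous (at t within {0..t + 1}) A"
      using t by (auto simp: continuous_on_eq_continuous_within)
    moreover have "at t within {0..} = at t within {0..t + 1}"
      using t by (intro at_within_nhd[of t "{..<t + 1}"]) auto
    ultimately show "continuous (at t within {0..}) A"
      by simp
  qed
  have A_lower: "\<alpha>bar * (t - T) / T \<le> A t" if "t \<ge> 0" for t
    unfolding A_def
  proof (rule integral_lower_bound_recurrent[where \<tau> = \<tau>])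
    show "\<tau> (Suc n) - \<tau> n \<le> T" "\<alpha>bar \<le> integral {\<tau> n..\<tau> (Suc n)} \<alpha>" for n
      using assms(11)[rule_format, of "Suc n"] by auto
  qed (use assms alpha that in auto)
  \<comment> \<open>Distances decay at rate \<open>\<psi> p\<close> in the variable
    \<open>A t\<close>, which grows on average by at least \<open>\<alpha>bar / T\<close> per unit
    time.\<close>
  define \<gamma> where "\<gamma> = \<psi> p * \<alpha>bar / T"
  have decay: "opinion_diameter N x t \<le> opinion_diameter N x 0 * exp (- \<gamma> * (t - T))"
    if N: "N \<ge> 2" and init: "\<forall>i\<in>{1..N}. norm (x0 i) \<le> R"
      and sol: "HK_solution N \<psi> \<alpha> x0 x" and t: "t \<ge> 0" for N x0 x t
  proof (rule opinion_diameter_le)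
    fix i j assume ij: "i \<in> {1..N}" "j \<in> {1..N}"
    have in_ball: "norm (x k s) \<le> R" if "k \<in> {1..N}" "s \<ge> 0" for k s
      using that init by (intro HK_solution_norm_le[OF sol N psi alpha]) auto
    have "\<psi> p \<le> \<psi> (x k s, x l s)" if "k \<in> {1..N}" "l \<in> {1..N}" "s \<ge> 0" for k l s
      using in_ball[of k s] in_ball[of l s] that by (intro p) (auto simp: B_def)
    from HK_solution_diff_decay[OF sol N less_imp_le[OF psi] this alpha A_cont _ A_der ij t]
    obtain k l where kl: "k \<in> {1..N}" "l \<in> {1..N}"
        "norm (x i t - x j t) \<le> norm (x k 0 - x l 0) * exp (- \<psi> p * A t)"
      by (auto simp: A_def)
    have "\<gamma> * (t - T) \<le> \<psi> p * A t"
      using mult_left_mono[OF A_lower[OF t] less_imp_le[OF psi[of p]]] by (simp add: \<gamma>_def)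
    then have "exp (- \<psi> p * A t) \<le> exp (- \<gamma> * (t - T))" by simp
    with kl(3) norm_le_opinion_diameter[OF kl(1,2), of x 0]
    show "norm (x i t - x j t) \<le> opinion_diameter N x 0 * exp (- \<gamma> * (t - T))"
      by (smt (verit) mult_mono norm_ge_zero exp_ge_zero)
  qed (use N in simp)
  have "\<gamma> > 0"
    using psi assms(6,7) by (simp add: \<gamma>_def)
  with decay show ?thesis by blast
qed

end
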